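(* For an arbitrarily chosen $\boldsymbol\Gamma\ge0$ (componentwise), if the optimal values $C_1(\boldsymbol\Gamma_1),\ldots,C_K(\boldsymbol\Gamma_K)$ form a rate-tuple that is Pareto optimal on the boundary of the rate region $\mathcal R$, then for any pair $(i,j)$ with $i,j\in\{1,\ldots,K\}$ and $i\ne j$, it must hold that $|\mathbf D_{ij}|=0$, where $|\cdot|$ is the determinant and $$\mathbf D_{ij}=\begin{bmatrix}\dfrac{\partial C_i(\boldsymbol\Gamma_i)}{\partial\Gamma_{ij}} & \dfrac{\partial C_i(\boldsymbol\Gamma_i)}{\partial\Gamma_{ji}}\\[2ex] \dfrac{\partial C_j(\boldsymbol\Gamma_j)}{\partial\Gamma_{ij}} & \dfrac{\partial C_j(\boldsymbol\Gamma_j)}{\partial\Gamma_{ji}}\end{bmatrix}.$$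
   Context: Setting: the $K$-user multiple-input single-output interference channel (MISO-IC) with interference treated as noise. Transmitter $k$ has $M_k\ge1$ antennas; $\mathbf h_{kj}\in\mathbb C^{M_k\times1}$ is the channel vector from transmitter $k$ to receiver $j$; $\sigma_k^2$ is the noise power at receiver $k$; $P_k$ is the power budget of transmitter $k$. $\log$ has base 2. For positive semidefinite $\mathbf S_k\in\mathbb C^{M_k\times M_k}$ (transmit covariance matrices), the achievable rate of user $k$ is $$R_k(\mathbf S_1,\ldots,\mathbf S_K)=\log\Big(1+\frac{\mathbf h_{kk}^H\mathbf S_k\mathbf h_{kk}}{\sum_{j\ne k}\mathbf h_{jk}^H\mathbf S_j\mathbf h_{jk}+\sigma_k^2}\Big),$$ and the achievable rate region is $$\mathcal R=\bigcup_{\{\mathbf S_k\succeq0\}:\ \mathrm{Tr}(\mathbf S_k)\le P_k,\ k=1,\ldots,K}\big\{(r_1,\ldots,r_K):0\le r_k\le R_k(\mathbf S_1,\ldots,\mathbf S_K),\ k=1,\ldots,K\big\}.$$ A rate-tuple $r\in\mathcal R$ is Pareto optimal if there is no other rate-tuple $r'\in\mathcal R$ with $r'\ge r$ componentwise and $r'\ne r$. For non-negative reals $\Gamma_{kj}$ ($k\ne j$), $\boldsymbol\Gamma$ is the vector of all $K(K-1)$ of them, and $\boldsymbol\Gamma_k$ is the vector of the $2(K-1)$ values $\Gamma_{kj},\Gamma_{jk}$, $j\ne k$. $C_k(\boldsymbol\Gamma_k)$ denotes the optimal value, as a function of $\boldsymbol\Gamma_k$, of $$\max_{\mathbf S_k}\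 \log\Big(1+\frac{\mathbf h_{kk}^H\mathbf S_k\mathbf h_{kk}}{\sum_{j\ne k}\Gamma_{jk}+\sigma_k^2}\Big)\quad\text{s.t.}\quad \mathbf h_{kj}^H\mathbf S_k\mathbf h_{kj}\le\Gamma_{kj}\ \forall j\neq k,\quad \mathrm{Tr}(\mathbf S_k)\le P_k,\quad \mathbf S_k\succeq 0 .$$ The entries of $\mathbf D_{ij}$ are obtained from the primal and dual solutions of these problems: $\partial C_i(\boldsymbol\Gamma_i)/\partial\Gamma_{ij}=\lambda_{ij}$, where $\lambda_{ij}$ is the solution of the Lagrange dual of the problem with $k=i$ for the dual variable of the constraint $\mathbf h_{ij}^H\mathbf S_i\mathbf h_{ij}\le\Gamma_{ij}$, and $$\frac{\partial C_i(\boldsymbol\Gamma_i)}{\partial\Gamma_{ji}}=\frac{-\mathbf h_{ii}^H\mathbf S_i^\star\mathbf h_{ii}}{\ln 2\,\big(\sum_{l\ne i}\Gamma_{li}+\sigma_i^2\big)\big(\sum_{l\ne i}\Gamma_{li}+\sigma_i^2+\mathbf h_{ii}^H\mathbf S_i^\star\mathbf h_{ii}\big)},$$ where $\mathbf S_i^\star$ is the optimal solution of the problem with $k=i$; the derivatives of $C_j$ are obtained in the same way from the problem with $k=j$.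
   Formalization: For the pair considered, the partial derivatives of C_i in Γ_ij and of C_j in Γ_ji are assumed to exist (two-sided, so Γ_ij, Γ_ji > 0); at corners or at zero thresholds the dual solution is not unique and the claim can fail. *)

theory Defs
  imports
    "HOL-Analysis.Analysis"
    "Jordan_Normal_Form.Schur_Decomposition"
begin

text \<open>
  Users are the elements of a finite type \<open>'k\<close>.  The numbers of antennas \<open>M k\<close> differ from
  user to user, so vectors and matrices are those of \<open>Jordan_Normal_Form\<close>, whose dimension
  is not part of the type.
  \<open>h k j\<close> is the channel vector from transmitter \<open>k\<close> to receiver \<open>j\<close>; \<open>G k j\<close> is the
  value \<open>\<Gamma>\<close> indexed by \<open>kj\<close> (the diagonal \<open>G k k\<close> is never used); \<open>\<sigma> k\<close> is the standard
  deviation of the noise, so that the noise power is \<open>(\<sigma> k)\<^sup>2\<close>.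
\<close>

definition psd_mat :: "nat \<Rightarrow> complex mat \<Rightarrow> bool" where
  "psd_mat n S \<longleftrightarrow> S \<in> carrier_mat n n \<and> mat_adjoint S = S \<and>
     (\<forall>x \<in> carrier_vec n. 0 \<le> (S *\<^sub>v x) \<bullet>c x)"

definition trace_mat :: "complex mat \<Rightarrow> complex" where
  "trace_mat S = (\<Sum>i<dim_row S. S $$ (i, i))"

text \<open>\<open>(S h) \<bullet>c h = h\<^sup>H S h\<close>; this number and the trace are real for Hermitian \<open>S\<close>, so
  taking real parts below loses nothing.\<close>

definition rx_power :: "complex Matrix.vec \<Rightarrow> complex mat \<Rightarrow> real" where
  "rx_power v S = Re ((S *\<^sub>v v) \<bullet>c v)"

definition tx_cov :: "('k \<Rightarrow> nat) \<Rightarrow> ('k \<Rightarrow> real) \<Rightarrow> 'k \<Rightarrow> complex mat set" where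
  "tx_cov M P k = {S. psd_mat (M k) S \<and> Re (trace_mat S) \<le> P k}"

definition rate ::
  "('k::finite \<Rightarrow> 'k \<Rightarrow> complex Matrix.vec) \<Rightarrow> ('k \<Rightarrow> real) \<Rightarrow> ('k \<Rightarrow> complex mat) \<Rightarrow> 'k \<Rightarrow> real" where
  "rate h \<sigma> S k =
     log 2 (1 + rx_power (h k k) (S k) / ((\<Sum>j\<in>UNIV - {k}. rx_power (h j k) (S j)) + (\<sigma> k)\<^sup>2))"

definition rate_region ::
  "('k::finite \<Rightarrow> nat) \<Rightarrow> ('k \<Rightarrow> 'k \<Rightarrow> complex Matrix.vec) \<Rightarrow> ('k \<Rightarrow> real) \<Rightarrow> ('k \<Rightarrow> real)
     \<Rightarrow> ('k \<Rightarrow> real) set" where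
  "rate_region M h \<sigma> P =
     (\<Union>S \<in> {S. \<forall>k. S k \<in> tx_cov M P k}. {r. \<forall>k. 0 \<le> r k \<and> r k \<le> rate h \<sigma> S k})"

definition pareto_optimal :: "('k \<Rightarrow> real) set \<Rightarrow> ('k \<Rightarrow> real) \<Rightarrow> bool" where
  "pareto_optimal R r \<longleftrightarrow> r \<in> R \<and> \<not> (\<exists>r'\<in>R. (\<forall>k. r k \<le> r' k) \<and> r' \<noteq> r)"

definition feasible_cov ::
  "('k \<Rightarrow> nat) \<Rightarrow> ('k \<Rightarrow> 'k \<Rightarrow> complex Matrix.vec) \<Rightarrow> ('k \<Rightarrow> real) \<Rightarrow> ('k \<Rightarrow> 'k \<Rightarrow> real) \<Rightarrow> 'k
     \<Rightarrow> complex mat set" where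
  "feasible_cov M h P G k = {S \<in> tx_cov M P k. \<forall>j. j \<noteq> k \<longrightarrow> rx_power (h k j) S \<le> G k j}"

definition opt_rate ::
  "('k::finite \<Rightarrow> nat) \<Rightarrow> ('k \<Rightarrow> 'k \<Rightarrow> complex Matrix.vec) \<Rightarrow> ('k \<Rightarrow> real) \<Rightarrow> ('k \<Rightarrow> real)
     \<Rightarrow> ('k \<Rightarrow> 'k \<Rightarrow> real) \<Rightarrow> 'k \<Rightarrow> real" where
  "opt_rate M h \<sigma> P G k =
     (SUP S \<in> feasible_cov M h P G k.
        log 2 (1 + rx_power (h k k) S / ((\<Sum>j\<in>UNIV - {k}. G j k) + (\<sigma> k)\<^sup>2)))"

definition upd2 :: "('k \<Rightarrow> 'k \<Rightarrow> real) \<Rightarrow> 'k \<Rightarrow> 'k \<Rightarrow> real \<Rightarrow> 'k \<Rightarrow> 'k \<Rightarrow> real" where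
  "upd2 G a b x = G(a := (G a)(b := x))"

definition opt_rate_partial ::
  "('k::finite \<Rightarrow> nat) \<Rightarrow> ('k \<Rightarrow> 'k \<Rightarrow> complex Matrix.vec) \<Rightarrow> ('k \<Rightarrow> real) \<Rightarrow> ('k \<Rightarrow> real)
     \<Rightarrow> ('k \<Rightarrow> 'k \<Rightarrow> real) \<Rightarrow> 'k \<Rightarrow> 'k \<Rightarrow> 'k \<Rightarrow> real" where
  "opt_rate_partial M h \<sigma> P G k a b = deriv (\<lambda>x. opt_rate M h \<sigma> P (upd2 G a b x) k) (G a b)"

text \<open>
  Existence of the partial derivative of \<open>C\<^sub>k\<close> with respect to \<open>G a b\<close>.  The optimal value is
  meaningful only where the problem is feasible (a supremum over the empty set is an unspecified
  real), so feasibility is required in a neighbourhood.  For \<open>a = k\<close> this excludes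
  \<open>G k b = 0\<close>, where decreasing \<open>G k b\<close> makes the problem infeasible.
\<close>

definition opt_rate_has_partial ::
  "('k::finite \<Rightarrow> nat) \<Rightarrow> ('k \<Rightarrow> 'k \<Rightarrow> complex Matrix.vec) \<Rightarrow> ('k \<Rightarrow> real) \<Rightarrow> ('k \<Rightarrow> real)
     \<Rightarrow> ('k \<Rightarrow> 'k \<Rightarrow> real) \<Rightarrow> 'k \<Rightarrow> 'k \<Rightarrow> 'k \<Rightarrow> bool" where
  "opt_rate_has_partial M h \<sigma> P G k a b \<longleftrightarrow>
     (\<forall>\<^sub>F x in nhds (G a b). feasible_cov M h P (upd2 G a b x) k \<noteq> {}) \<and>
     (\<lambda>x. opt_rate M h \<sigma> P (upd2 G a b x) k) differentiable (at (G a b))"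

text \<open>
  Only the existence of the diagonal entries \<open>\<partial>C\<^sub>i/\<partial>G i j\<close> and \<open>\<partial>C\<^sub>j/\<partial>G j i\<close> ever needs to be
  assumed: if the problem is feasible and \<open>\<sigma> i \<noteq> 0\<close>, \<open>G \<ge> 0\<close>, then \<open>C\<^sub>i\<close> depends on \<open>G j i\<close> only
  through the positive denominator of the objective, hence smoothly.
\<close>

definition D_matrix ::
  "('k::finite \<Rightarrow> nat) \<Rightarrow> ('k \<Rightarrow> 'k \<Rightarrow> complex Matrix.vec) \<Rightarrow> ('k \<Rightarrow> real) \<Rightarrow> ('k \<Rightarrow> real)
     \<Rightarrow> ('k \<Rightarrow> 'k \<Rightarrow> real) \<Rightarrow> 'k \<Rightarrow> 'k \<Rightarrow> real^2^2" where
  "D_matrix M h \<sigma> P G i j =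
     vector [vector [opt_rate_partial M h \<sigma> P G i i j, opt_rate_partial M h \<sigma> P G i j i],
             vector [opt_rate_partial M h \<sigma> P G j i j, opt_rate_partial M h \<sigma> P G j j i]]"

end

theory Submission
  imports Defs
begin

text \<open>
  The optimum of the problem defining \<open>C\<^sub>k\<close> is attained, since the feasible covariances form a
  compact set.  Optimal covariances for nonnegative thresholds \<open>\<Gamma>\<close> cause at most the interference
  that \<open>\<Gamma>\<close> prescribes, so they achieve at least the rates \<open>C\<^sub>k(\<Gamma>)\<close>: every such tuple lies in the
  rate region.  If the determinant were nonzero, some direction in the plane of the two thresholds
  between users \<open>i\<close> and \<open>j\<close> would increase both \<open>C\<^sub>i\<close> and \<open>C\<^sub>j\<close> at unit speed.  No
  other \<open>C\<^sub>k\<close> depends on these thresholds, so a small step dominates the Pareto optimum.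
\<close>

section \<open>Entry bounds for positive semidefinite matrices\<close>

lemma cscalar_mult_mat_vec_eq_sum:
  fixes S :: "complex mat"
  assumes "S \<in> carrier_mat n n" "x \<in> carrier_vec n"
  shows "(S *\<^sub>v x) \<bullet>c x =
    (\<Sum>a<n. \<Sum>b<n. S $$ (a, b) * vec_index x b * cnj (vec_index x a))"
  using assms
  by (auto simp: scalar_prod_def sum_distrib_right lessThan_atLeast0 intro!: sum.cong)

text \<open>Being Hermitian becomes a system of equations between entries, in which conjugate
  entries can be exchanged and from which closedness can be read off.\<close>

lemma mat_adjoint_eq_iff:
  fixes S :: "complex mat"
  assumes "S \<in> carrier_mat n n"
  shows "mat_adjoint S = S \<longleftrightarrow> (\<forall>a<n. \<forall>b<n. S $$ (a, b) = cnj (S $$ (b, a)))"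
proof -
  have "mat_adjoint S = Matrix.mat n n (\<lambda>(a, b). cnj (S $$ (b, a)))"
    using assms by (intro eq_matI) (auto simp: mat_adjoint_def mat_of_rows_def)
  moreover have "Matrix.mat n n f = S \<longleftrightarrow> (\<forall>a<n. \<forall>b<n. S $$ (a, b) = f (a, b))" for f
    using assms by (auto simp: mat_eq_iff)
  ultimately show ?thesis
    by simp
qed

lemma psd_mat_diag_nonneg:
  assumes S: "psd_mat n S" and a: "a < n"
  shows "0 \<le> Re (S $$ (a, a))"
proof -
  have "0 \<le> (S *\<^sub>v unit_vec n a) \<bullet>c unit_vec n a"
    using S by (simp add: psd_mat_def)
  also have "\<dots> = (\<Sum>c<n. \<Sum>d<n. if c = a \<and> d = a then S $$ (c, d) else 0)"
    using S unfolding psd_mat_def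
    by (subst cscalar_mult_mat_vec_eq_sum) (auto simp: unit_vec_def intro!: sum.cong)
  also have "\<dots> = (\<Sum>c<n. if c = a then S $$ (c, a) else 0)"
    using a by (intro sum.cong) auto
  also have "\<dots> = S $$ (a, a)"
    using a by simp
  finally show ?thesis
    by (simp add: less_eq_complex_def)
qed

text \<open>The form is tested on \<open>e_a + z e_b\<close>, with the phase of \<open>z\<close>
  chosen so that each cross term equals minus the modulus of the off-diagonal entry. An arithmetic
  mean of diagonal entries is enough, because the trace controls it.\<close>

lemma psd_mat_entry_bound:
  assumes S: "psd_mat n S" and a: "a < n" and b: "b < n" and ne: "a \<noteq> b"
  shows "2 * cmod (S $$ (a, b)) \<le> Re (S $$ (a, a)) + Re (S $$ (b, b))"
proof -
  define s where "s = S $$ (a, b)"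
  \<comment> \<open>For \<open>s = 0\<close> this gives \<open>z = 0\<close>, so only
    \<open>cmod z \<le> 1\<close> holds in general. That suffices, since the diagonal entry
    multiplied by the squared modulus of \<open>z\<close> is nonnegative.\<close>
  define z where "z = - cnj (sgn s)"
  define x where "x = Matrix.vec n (\<lambda>c. if c = a then 1 else if c = b then z else 0)"
  have carr: "S \<in> carrier_mat n n" "x \<in> carrier_vec n"
    using S by (auto simp: psd_mat_def x_def)
  have herm: "S $$ (b, a) = cnj s"
    using S a b mat_adjoint_eq_iff[OF carr(1)] unfolding psd_mat_def s_def by blast
  have two: "(\<Sum>c<n. f c) = f a + f b"
    if "\<And>c. c \<noteq> a \<Longrightarrow> c \<noteq> b \<Longrightarrow> f c = 0" for f :: "nat \<Rightarrow> complex"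
  proof -
    have "(\<Sum>c<n. f c) = (\<Sum>c\<in>{a, b}. f c)"
      by (rule sum.mono_neutral_right) (use that a b in auto)
    then show ?thesis using ne by simp
  qed
  have "z * s = - (s * cnj s) / complex_of_real (cmod s)"
    by (simp add: z_def sgn_eq)
  also have "\<dots> = - complex_of_real (cmod s)"
    by (simp add: power2_eq_square flip: complex_norm_square)
  finally have zs: "z * s = - complex_of_real (cmod s)" .
  have z_le: "cmod z \<le> 1"
    by (simp add: z_def norm_sgn)
  have "(S *\<^sub>v x) \<bullet>c x =
      (\<Sum>c<n. \<Sum>d<n. S $$ (c, d) * (if d = a then 1 else if d = b then z else 0) *
        cnj (if c = a then 1 else if c = b then z else 0))"
    unfolding cscalar_mult_mat_vec_eq_sum[OF carr] by (auto simp: x_def intro!: sum.cong)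
  also have "\<dots> = S $$ (a, a) + s * z + (cnj s * cnj z + S $$ (b, b) * (z * cnj z))"
    using ne by (subst two) (auto simp: two herm s_def)
  also have "\<dots> = S $$ (a, a) - 2 * cmod s + S $$ (b, b) * complex_of_real ((cmod z)\<^sup>2)"
    using zs by (simp add: complex_norm_square mult.commute del: of_real_power flip: complex_cnj_mult)
  finally have "0 \<le> Re (S $$ (a, a) - 2 * cmod s + S $$ (b, b) * complex_of_real ((cmod z)\<^sup>2))"
    using S carr(2) by (auto simp: psd_mat_def less_eq_complex_def)
  then have "0 \<le> Re (S $$ (a, a)) - 2 * cmod s + Re (S $$ (b, b)) * (cmod z)\<^sup>2"
    by simp
  moreover have "Re (S $$ (b, b)) * (cmod z)\<^sup>2 \<le> Re (S $$ (b, b)) * 1"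
    using psd_mat_diag_nonneg[OF S b] z_le by (intro mult_left_mono) (auto intro: power_le_one)
  ultimately show ?thesis by (simp add: s_def)
qed

text \<open>The diagonal entries are nonnegative with sum at most \<open>P k\<close>, so any one or
  two of them add up to at most \<open>P k\<close>; the off-diagonal entries follow. This is the
  boundedness half of compactness.\<close>

lemma tx_cov_entry_bound:
  assumes S: "S \<in> tx_cov M P k" and a: "a < M k" and b: "b < M k"
  shows "cmod (S $$ (a, b)) \<le> P k"
proof -
  have psd: "psd_mat (M k) S" and tr: "Re (trace_mat S) \<le> P k"
    using S by (auto simp: tx_cov_def)
  have trace: "(\<Sum>c<M k. Re (S $$ (c, c))) \<le> P k"
    using psd tr by (auto simp: psd_mat_def trace_mat_def)
  have diag: "0 \<le> Re (S $$ (c, c))" if "c < M k" for c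
    using psd_mat_diag_nonneg[OF psd that] .
  show ?thesis
  proof (cases "a = b")
    case True
    have "S $$ (a, a) = cnj (S $$ (a, a))"
      using psd a mat_adjoint_eq_iff[of S "M k"] unfolding psd_mat_def by blast
    then have "Im (S $$ (a, a)) = 0"
      by (simp add: complex_eq_iff)
    then have "cmod (S $$ (a, a)) = Re (S $$ (a, a))"
      using diag[OF a] by (simp add: cmod_eq_Re)
    also have "\<dots> \<le> (\<Sum>c<M k. Re (S $$ (c, c)))"
      using a diag by (intro member_le_sum) auto
    finally show ?thesis using trace True by simp
  next
    case False
    have "2 * cmod (S $$ (a, b)) \<le> (\<Sum>c\<in>{a, b}. Re (S $$ (c, c)))"
      using psd_mat_entry_bound[OF psd a b False] False by simp
    also have "\<dots> \<le> (\<Sum>c<M k. Re (S $$ (c, c)))"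
      using a b diag by (intro sum_mono2) auto
    finally show ?thesis using trace norm_ge_zero[of "S $$ (a, b)"] by linarith
  qed
qed

lemma rx_power_nonneg: "psd_mat n S \<Longrightarrow> v \<in> carrier_vec n \<Longrightarrow> 0 \<le> rx_power v S"
  by (auto simp: psd_mat_def rx_power_def less_eq_complex_def)

section \<open>Compactness of the feasible set and attainment of the optimum\<close>

lemma continuous_on_proj:
  fixes p :: "nat \<times> nat"
  shows "continuous_on UNIV (\<lambda>f :: nat \<times> nat \<Rightarrow> complex. f p)"
  by (rule continuous_on_product_coordinates)

text \<open>A matrix is represented by a function on index pairs, under the product topology; the
  form is then a finite sum of scaled coordinate projections.\<close>

lemma continuous_on_quadratic_form:
  fixes x :: "complex Matrix.vec"
  assumes "x \<in> carrier_vec n"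
  shows "continuous_on UNIV (\<lambda>f. (Matrix.mat n n f *\<^sub>v x) \<bullet>c x)"
proof -
  have "(\<lambda>f. (Matrix.mat n n f *\<^sub>v x) \<bullet>c x) =
      (\<lambda>f. \<Sum>a<n. \<Sum>b<n. f (a, b) * vec_index x b * cnj (vec_index x a))"
    using assms by (auto simp: cscalar_mult_mat_vec_eq_sum[OF mat_carrier] fun_eq_iff)
  then show ?thesis
    by (simp only:) (intro continuous_intros continuous_on_proj)
qed

lemma continuous_on_rx_power:
  "x \<in> carrier_vec n \<Longrightarrow> continuous_on UNIV (\<lambda>f. rx_power x (Matrix.mat n n f))"
  unfolding rx_power_def by (intro continuous_on_Re continuous_on_quadratic_form)

lemma closed_Collect_ball:
  assumes "\<And>x. x \<in> A \<Longrightarrow> closed {f. P f x}"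
  shows "closed {f. \<forall>x\<in>A. P f x}"
proof -
  have "{f. \<forall>x\<in>A. P f x} = (\<Inter>x\<in>A. {f. P f x})"
    by auto
  then show ?thesis using assms by auto
qed

text \<open>In the order on complex numbers, nonnegativity means a nonnegative real part and a
  vanishing imaginary part. The set is thus an intersection of closed conditions, one family of them
  indexed by all test vectors.\<close>

lemma closed_psd_mat: "closed {f. psd_mat n (Matrix.mat n n f)}"
proof -
  have "{f. psd_mat n (Matrix.mat n n f)} =
      {f. \<forall>a\<in>{..<n}. \<forall>b\<in>{..<n}. f (a, b) = cnj (f (b, a))} \<inter>
      {f. \<forall>x\<in>carrier_vec n. 0 \<le> Re ((Matrix.mat n n f *\<^sub>v x) \<bullet>c x) \<and>
        Im ((Matrix.mat n n f *\<^sub>v x) \<bullet>c x) = 0}"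
    unfolding psd_mat_def
    by (auto simp: mat_adjoint_eq_iff[OF mat_carrier] less_eq_complex_def)
  also have "closed \<dots>"
    by (intro closed_Int closed_Collect_ball closed_Collect_conj
        closed_Collect_le closed_Collect_eq continuous_on_Re continuous_on_Im
        continuous_on_quadratic_form continuous_intros continuous_on_proj)
  finally show ?thesis .
qed

lemma feasible_cov_compact_image:
  assumes channels: "\<And>l. h k l \<in> carrier_vec (M k)"
  obtains F :: "(nat \<times> nat \<Rightarrow> complex) set"
    where "compact F" "feasible_cov M h P G k = Matrix.mat (M k) (M k) ` F"
proof
  define n where "n = M k"
  \<comment> \<open>All coordinates are bounded, also those outside the matrix, so that
    \<open>B\<close> is a product of balls and Tychonoff's theorem applies. The absolute value keeps
    the radius nonnegative, as the sign of \<open>P k\<close> is not known here.\<close>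
  define B where "B = {f :: nat \<times> nat \<Rightarrow> complex. \<forall>p. f p \<in> cball 0 \<bar>P k\<bar>}"
  define C where "C = {f. psd_mat n (Matrix.mat n n f)} \<inter>
    ({f. (\<Sum>a<n. Re (f (a, a))) \<le> P k} \<inter>
     {f. \<forall>l. l \<noteq> k \<longrightarrow> rx_power (h k l) (Matrix.mat n n f) \<le> G k l})"
  have "compactin (product_topology (\<lambda>_. euclidean) UNIV)
      (\<Pi>\<^sub>E p\<in>(UNIV :: (nat \<times> nat) set). cball (0 :: complex) \<bar>P k\<bar>)"
    by (subst compactin_PiE) auto
  moreover have "(\<Pi>\<^sub>E p\<in>(UNIV :: (nat \<times> nat) set). cball (0 :: complex) \<bar>P k\<bar>) = B"
    by (auto simp: B_def PiE_def Pi_def)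
  ultimately have "compact B"
    by (simp add: euclidean_product_topology)
  moreover have "closed C"
    unfolding C_def
  proof (intro closed_Int closed_psd_mat)
    show "closed {f :: nat \<times> nat \<Rightarrow> complex. (\<Sum>a<n. Re (f (a, a))) \<le> P k}"
      by (intro closed_Collect_le continuous_intros continuous_on_proj)
    show "closed {f. \<forall>l. l \<noteq> k \<longrightarrow> rx_power (h k l) (Matrix.mat n n f) \<le> G k l}"
      by (intro closed_Collect_all closed_Collect_imp closed_Collect_le continuous_on_rx_power
          continuous_intros) (use channels in \<open>auto simp: n_def\<close>)
  qed
  ultimately show "compact (B \<inter> C)"
    by (rule compact_Int_closed)
  have C_iff: "f \<in> C \<longleftrightarrow> Matrix.mat n n f \<in> feasible_cov M h P G k" for f
    by (auto simp: C_def feasible_cov_def tx_cov_def trace_mat_def n_def)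
  have "S \<in> Matrix.mat n n ` (B \<inter> C)" if S: "S \<in> feasible_cov M h P G k" for S
  proof -
    \<comment> \<open>Coordinates outside the matrix are set to 0, which lies in every ball of the
      box.\<close>
    define f where "f p = (if fst p < n \<and> snd p < n then S $$ p else 0)" for p
    have cov: "S \<in> tx_cov M P k"
      using S by (simp add: feasible_cov_def)
    then have eq: "S = Matrix.mat n n f"
      by (intro eq_matI) (auto simp: tx_cov_def psd_mat_def f_def n_def)
    have "f \<in> B"
      using tx_cov_entry_bound[OF cov] unfolding B_def f_def n_def
      by (fastforce intro: order_trans[OF _ abs_ge_self])
    moreover have "f \<in> C"
      using S eq C_iff by simp
    ultimately show ?thesis
      using eq by blast
  qed
  then show "feasible_cov M h P G k = Matrix.mat (M k) (M k) ` (B \<inter> C)"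
    using C_iff by (auto simp flip: n_def)
qed

text \<open>The part of the optimum that depends on the outgoing thresholds \<open>G k l\<close>
  alone; the incoming ones \<open>G l k\<close> enter only the denominator of the rate.\<close>

definition max_power ::
  "('k \<Rightarrow> nat) \<Rightarrow> ('k \<Rightarrow> 'k \<Rightarrow> complex Matrix.vec) \<Rightarrow> ('k \<Rightarrow> real) \<Rightarrow> ('k \<Rightarrow> 'k \<Rightarrow> real) \<Rightarrow> 'k \<Rightarrow> real"
  where "max_power M h P G k = (SUP S \<in> feasible_cov M h P G k. rx_power (h k k) S)"

text \<open>A continuous function attains its supremum on the compact set of coefficient functions
  whose image is the feasible set.\<close>

lemma max_power_attained:
  assumes channels: "\<And>l. h k l \<in> carrier_vec (M k)"
    and ne: "feasible_cov M h P G k \<noteq> {}"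
  obtains S where "S \<in> feasible_cov M h P G k" "rx_power (h k k) S = max_power M h P G k"
    "\<And>T. T \<in> feasible_cov M h P G k \<Longrightarrow> rx_power (h k k) T \<le> rx_power (h k k) S"
proof -
  obtain F where F: "compact F" "feasible_cov M h P G k = Matrix.mat (M k) (M k) ` F"
    using feasible_cov_compact_image[of h k M P G] channels by blast
  have "continuous_on F (\<lambda>f. rx_power (h k k) (Matrix.mat (M k) (M k) f))"
    using continuous_on_subset[OF continuous_on_rx_power[OF channels]] by blast
  then obtain f where f: "f \<in> F"
    "\<forall>g\<in>F. rx_power (h k k) (Matrix.mat (M k) (M k) g) \<le> rx_power (h k k) (Matrix.mat (M k) (M k) f)"
    using continuous_attains_sup[OF F(1)] ne F(2) by blast
  show thesis
  proof
    show mem: "Matrix.mat (M k) (M k) f \<in> feasible_cov M h P G k"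
      using f(1) F(2) by blast
    show max: "rx_power (h k k) T \<le> rx_power (h k k) (Matrix.mat (M k) (M k) f)"
      if "T \<in> feasible_cov M h P G k" for T
      using that f(2) F(2) by auto
    show "rx_power (h k k) (Matrix.mat (M k) (M k) f) = max_power M h P G k"
      unfolding max_power_def using mem max by (intro cSup_eq_maximum[symmetric]) auto
  qed
qed

lemma max_power_nonneg:
  assumes channels: "\<And>l. h k l \<in> carrier_vec (M k)"
    and ne: "feasible_cov M h P G k \<noteq> {}"
  shows "0 \<le> max_power M h P G k"
proof -
  obtain S where "S \<in> feasible_cov M h P G k" "rx_power (h k k) S = max_power M h P G k"
    using max_power_attained[OF assms] by metis
  then show ?thesis
    using rx_power_nonneg[of "M k" S "h k k"] channels by (auto simp: feasible_cov_def tx_cov_def)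
qed

text \<open>The denominator is independent of the covariance and the logarithm is increasing, so a
  covariance of maximal received power also maximises the rate.\<close>

lemma opt_rate_eq:
  fixes h :: "'k::finite \<Rightarrow> 'k \<Rightarrow> complex Matrix.vec"
  assumes channels: "\<And>l. h k l \<in> carrier_vec (M k)"
    and ne: "feasible_cov M h P G k \<noteq> {}"
    and pos: "0 < (\<Sum>j\<in>UNIV - {k}. G j k) + (\<sigma> k)\<^sup>2"
  shows "opt_rate M h \<sigma> P G k =
    log 2 (1 + max_power M h P G k / ((\<Sum>j\<in>UNIV - {k}. G j k) + (\<sigma> k)\<^sup>2))"
proof -
  define d where "d = (\<Sum>j\<in>UNIV - {k}. G j k) + (\<sigma> k)\<^sup>2"
  have d: "0 < d" using pos by (simp add: d_def)
  obtain S where S: "S \<in> feasible_cov M h P G k" "rx_power (h k k) S = max_power M h P G k"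
    "\<And>T. T \<in> feasible_cov M h P G k \<Longrightarrow> rx_power (h k k) T \<le> rx_power (h k k) S"
    using max_power_attained[of h k M P G] channels ne by metis
  have nonneg: "0 \<le> rx_power (h k k) T" if "T \<in> feasible_cov M h P G k" for T
    using that rx_power_nonneg[of "M k" T "h k k"] channels
    by (auto simp: feasible_cov_def tx_cov_def)
  have "(SUP T \<in> feasible_cov M h P G k. log 2 (1 + rx_power (h k k) T / d)) =
      log 2 (1 + max_power M h P G k / d)"
  proof (rule cSup_eq_maximum)
    show "log 2 (1 + max_power M h P G k / d) \<in>
        (\<lambda>T. log 2 (1 + rx_power (h k k) T / d)) ` feasible_cov M h P G k"
      using S by (auto intro!: image_eqI[of _ _ S])
    fix y assume "y \<in> (\<lambda>T. log 2 (1 + rx_power (h k k) T / d)) ` feasible_cov M h P G k"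
    then obtain T where T: "T \<in> feasible_cov M h P G k" "y = log 2 (1 + rx_power (h k k) T / d)"
      by blast
    have "0 \<le> rx_power (h k k) T / d"
      using nonneg[OF T(1)] d by simp
    moreover have "rx_power (h k k) T / d \<le> max_power M h P G k / d"
      using S(2) S(3)[OF T(1)] d by (simp add: divide_right_mono)
    ultimately show "y \<le> log 2 (1 + max_power M h P G k / d)"
      unfolding T(2) by (intro log_mono) auto
  qed
  then show ?thesis
    by (simp add: opt_rate_def d_def)
qed

section \<open>Achievability of the optimal rates\<close>

lemma opt_rate_in_rate_region:
  fixes h :: "'k::finite \<Rightarrow> 'k \<Rightarrow> complex Matrix.vec"
  assumes channels: "\<And>k l. h k l \<in> carrier_vec (M k)"
    and noise: "\<And>k. 0 < \<sigma> k"
    and G_nonneg: "\<And>k l. k \<noteq> l \<Longrightarrow> 0 \<le> G k l"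
    and ne: "\<And>k. feasible_cov M h P G k \<noteq> {}"
  shows "opt_rate M h \<sigma> P G \<in> rate_region M h \<sigma> P"
proof -
  have "\<exists>T. T \<in> feasible_cov M h P G k \<and> rx_power (h k k) T = max_power M h P G k" for k
    using max_power_attained[of h k M P G] channels ne by metis
  then obtain S where S: "\<And>k. S k \<in> feasible_cov M h P G k"
    "\<And>k. rx_power (h k k) (S k) = max_power M h P G k"
    by metis
  have psd: "psd_mat (M k) (S k)" for k
    using S(1)[of k] by (simp add: feasible_cov_def tx_cov_def)
  have "0 \<le> opt_rate M h \<sigma> P G k \<and> opt_rate M h \<sigma> P G k \<le> rate h \<sigma> S k" for k
  proof -
    define d e where "d = (\<Sum>j\<in>UNIV - {k}. G j k) + (\<sigma> k)\<^sup>2"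
      and "e = (\<Sum>j\<in>UNIV - {k}. rx_power (h j k) (S j)) + (\<sigma> k)\<^sup>2"
    have s: "0 < (\<sigma> k)\<^sup>2" using noise[of k] by simp
    \<comment> \<open>The prescribed interference plus noise \<open>d\<close> dominates the actual
      value \<open>e\<close>, because each interferer respects its own threshold towards receiver
      \<open>k\<close>.\<close>
    have "e \<le> d"
      unfolding d_def e_def
    proof (intro add_right_mono sum_mono)
      fix j assume "j \<in> UNIV - {k}"
      then show "rx_power (h j k) (S j) \<le> G j k"
        using S(1)[of j] by (auto simp: feasible_cov_def)
    qed
    moreover have e: "0 < e"
      unfolding e_def using s psd channels
      by (intro add_nonneg_pos sum_nonneg rx_power_nonneg) auto
    ultimately have d: "0 < d" by simp
    have N: "0 \<le> max_power M h P G k"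
      using max_power_nonneg[of h k M P G] channels ne by blast
    have opt: "opt_rate M h \<sigma> P G k = log 2 (1 + max_power M h P G k / d)"
      using opt_rate_eq[of h k M P G \<sigma>] channels ne d by (simp add: d_def)
    have "0 \<le> opt_rate M h \<sigma> P G k"
      unfolding opt using N d by (intro zero_le_log_cancel_iff[THEN iffD2]) (auto intro: add_pos_nonneg)
    moreover have "opt_rate M h \<sigma> P G k \<le> log 2 (1 + max_power M h P G k / e)"
      unfolding opt using N d e \<open>e \<le> d\<close>
      by (intro log_mono add_left_mono divide_left_mono) (auto intro: add_pos_nonneg)
    ultimately show ?thesis
      by (simp add: rate_def S(2) e_def)
  qed
  moreover have "S k \<in> tx_cov M P k" for k
    using S(1)[of k] by (simp add: feasible_cov_def)
  ultimately show ?thesis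
    by (auto simp: rate_region_def)
qed

section \<open>Feasibility, dependence on the thresholds, and derivatives along lines\<close>

lemma zero_mem_feasible_cov:
  assumes "\<And>l. h k l \<in> carrier_vec (M k)" "0 \<le> P k" "\<And>l. l \<noteq> k \<Longrightarrow> 0 \<le> G k l"
  shows "0\<^sub>m (M k) (M k) \<in> feasible_cov M h P G k"
proof -
  have "mat_adjoint (0\<^sub>m n n :: complex mat) = 0\<^sub>m n n" for n
    by (subst mat_adjoint_eq_iff[of _ n]) auto
  moreover have "(0\<^sub>m n n *\<^sub>v x) \<bullet>c x = 0" if "x \<in> carrier_vec n" for n and x :: "complex Matrix.vec"
    using that by (subst cscalar_mult_mat_vec_eq_sum[of _ n]) auto
  ultimately show ?thesis
    using assms by (auto simp: feasible_cov_def tx_cov_def psd_mat_def trace_mat_def rx_power_def)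
qed

text \<open>Received power is never negative, so a negative threshold admits no covariance. This
  turns feasibility near a point into sign information on perturbed thresholds.\<close>

lemma feasible_cov_nonneg:
  assumes "\<And>l. h k l \<in> carrier_vec (M k)" "feasible_cov M h P G k \<noteq> {}" "l \<noteq> k"
  shows "0 \<le> G k l"
proof -
  obtain S where "psd_mat (M k) S" "rx_power (h k l) S \<le> G k l"
    using assms(2,3) by (auto simp: feasible_cov_def tx_cov_def)
  then show ?thesis
    using rx_power_nonneg[of "M k" S "h k l"] assms(1) by simp
qed

text \<open>The constraints of user \<open>k\<close> read only the off-diagonal entries of row
  \<open>k\<close>; changes in column \<open>k\<close> leave them intact.\<close>

lemma feasible_cov_cong:
  "(\<And>l. l \<noteq> k \<Longrightarrow> G k l = G' k l) \<Longrightarrow> feasible_cov M h P G k = feasible_cov M h P G' k"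
  by (auto simp: feasible_cov_def)

lemma max_power_cong:
  "(\<And>l. l \<noteq> k \<Longrightarrow> G k l = G' k l) \<Longrightarrow> max_power M h P G k = max_power M h P G' k"
  unfolding max_power_def by (subst feasible_cov_cong[of k G G']) auto

text \<open>
  Differentiability in each variable separately would not give the derivative along a line in
  general; here the dependence on \<open>y\<close> is explicit, and \<open>N\<close> inherits differentiability from
  \<open>x \<mapsto> F x y\<^sub>0\<close>.
\<close>

lemma log_rate_line_derivative:
  fixes F :: "real \<Rightarrow> real \<Rightarrow> real" and N :: "real \<Rightarrow> real"
  assumes F: "\<forall>\<^sub>F x in nhds x0. \<forall>y. 0 < y + c \<longrightarrow> F x y = log 2 (1 + N x / (y + c))"
    and N: "\<forall>\<^sub>F x in nhds x0. 0 \<le> N x"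
    and pos: "0 < y0 + c"
    and diff: "(\<lambda>x. F x y0) differentiable (at x0)"
  shows "((\<lambda>t. F (x0 + t * u) (y0 + t * v)) has_real_derivative
      deriv (\<lambda>x. F x y0) x0 * u + deriv (F x0) y0 * v) (at 0)"
proof -
  define d where "d = y0 + c"
  have d: "0 < d" using pos by (simp add: d_def)
  obtain a where a: "((\<lambda>x. F x y0) has_real_derivative a) (at x0)"
    using diff by (auto simp: real_differentiable_def)
  have N0: "0 \<le> N x0" and F0: "\<And>y. 0 < y + c \<Longrightarrow> F x0 y = log 2 (1 + N x0 / (y + c))"
    using eventually_nhds_x_imp_x[OF N] eventually_nhds_x_imp_x[OF F] by auto
  \<comment> \<open>The closed form at \<open>y0\<close> is solved for \<open>N x\<close>, with the
    power of 2 written through \<open>exp\<close>. Differentiability thereby passes from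
    \<open>F\<close> to \<open>N\<close>.\<close>
  have "\<forall>\<^sub>F x in nhds x0. (exp (F x y0 * ln 2) - 1) * d = N x"
    using F N
  proof eventually_elim
    case (elim x)
    then have "0 < 1 + N x / d" "F x y0 = log 2 (1 + N x / d)"
      using d by (auto simp: d_def intro: add_pos_nonneg)
    then show ?case using d by (simp add: log_def)
  qed
  moreover have "((\<lambda>x. (exp (F x y0 * ln 2) - 1) * d) has_real_derivative
      (exp (F x0 y0 * ln 2) * (a * ln 2) * d)) (at x0)"
    by (auto intro!: derivative_eq_intros a)
  ultimately have "(N has_real_derivative (exp (F x0 y0 * ln 2) * (a * ln 2) * d)) (at x0)"
    by (subst (asm) DERIV_cong_ev[OF refl _ refl])
  then obtain n where n: "(N has_real_derivative n) (at x0)"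
    by blast
  have p: "0 < 1 + N x0 / d" using N0 d by (auto intro: add_pos_nonneg)
  \<comment> \<open>The direction \<open>(u', v')\<close> is kept arbitrary: besides
    \<open>(u, v)\<close>, the two axis directions are needed below.\<close>
  have "((\<lambda>t. log 2 (1 + N (x0 + t * u') / (d + t * v'))) has_real_derivative
      n / (ln 2 * d * (1 + N x0 / d)) * u' + - N x0 / (ln 2 * d\<^sup>2 * (1 + N x0 / d)) * v') (at 0)"
    for u' v'
  proof -
    have "((\<lambda>t. x0 + t * u') has_real_derivative u') (at 0)"
      by (auto intro!: derivative_eq_intros)
    then have N': "((\<lambda>t. N (x0 + t * u')) has_real_derivative n * u') (at 0)"
      using DERIV_chain2[of N n "\<lambda>t. x0 + t * u'" 0 u' UNIV] n by simp
    define Z where "Z t = 1 + N (x0 + t * u') / (d + t * v')" for t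
    have Z': "(Z has_real_derivative (n * u' * d - N x0 * v') / (d * d)) (at 0)"
      unfolding Z_def using d by (auto intro!: derivative_eq_intros N')
    have Z0: "Z 0 = 1 + N x0 / d" "0 < Z 0"
      using p by (simp_all add: Z_def)
    have "((\<lambda>t. ln (Z t) / ln 2) has_real_derivative
        (n * u' * d - N x0 * v') / (d * d) / Z 0 / ln 2) (at 0)"
      using DERIV_cdivide[OF DERIV_chain2[OF DERIV_ln_divide[OF Z0(2)] Z'], of "ln 2"]
      by (simp add: ac_simps)
    moreover have "(n * u' * d - N x0 * v') / (d * d) / Z 0 / ln 2 =
        n / (ln 2 * d * Z 0) * u' + - N x0 / (ln 2 * d\<^sup>2 * Z 0) * v'"
      using d Z0(2) by (simp add: field_simps power2_eq_square)
    ultimately have "((\<lambda>t. ln (Z t) / ln 2) has_real_derivative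
        n / (ln 2 * d * Z 0) * u' + - N x0 / (ln 2 * d\<^sup>2 * Z 0) * v') (at 0)"
      by simp
    then show ?thesis
      unfolding Z0(1) unfolding Z_def log_def .
  qed
  \<comment> \<open>For small \<open>t\<close> the line stays where the closed form holds and the
    denominator is positive.\<close>
  moreover have "\<forall>\<^sub>F t in nhds 0. F (x0 + t * u') (y0 + t * v') =
      log 2 (1 + N (x0 + t * u') / (d + t * v'))" for u' v'
  proof -
    have "((\<lambda>t. x0 + t * u') \<longlongrightarrow> x0) (nhds 0)" "((\<lambda>t. y0 + t * v' + c) \<longlongrightarrow> y0 + c) (nhds 0)"
      by (auto intro!: tendsto_eq_intros filterlim_ident)
    then have "\<forall>\<^sub>F t in nhds 0. \<forall>y. 0 < y + c \<longrightarrow>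
          F (x0 + t * u') y = log 2 (1 + N (x0 + t * u') / (y + c))"
        "\<forall>\<^sub>F t in nhds 0. 0 < y0 + t * v' + c"
      using F pos order_tendstoD(1) by (auto simp: filterlim_iff)
    then show ?thesis
      by eventually_elim (simp add: d_def algebra_simps)
  qed
  ultimately have line: "((\<lambda>t. F (x0 + t * u') (y0 + t * v')) has_real_derivative
      n / (ln 2 * d * (1 + N x0 / d)) * u' + - N x0 / (ln 2 * d\<^sup>2 * (1 + N x0 / d)) * v') (at 0)"
    for u' v'
    by (subst DERIV_cong_ev[OF refl _ refl])
  \<comment> \<open>The axis directions \<open>(1, 0)\<close> and \<open>(0, 1)\<close> identify the
    two coefficients as the partial derivatives.\<close>
  have "((\<lambda>x. F x y0) has_real_derivative n / (ln 2 * d * (1 + N x0 / d))) (at x0)"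
    using line[of 1 0] DERIV_shift[of "\<lambda>x. F x y0" _ 0 x0] by (simp add: add.commute)
  moreover have "(F x0 has_real_derivative - N x0 / (ln 2 * d\<^sup>2 * (1 + N x0 / d))) (at y0)"
    using line[of 0 1] DERIV_shift[of "F x0" _ 0 y0] by (simp add: add.commute)
  ultimately show ?thesis
    using line[of u v] by (simp only: DERIV_imp_deriv)
qed

section \<open>Derivative of the optimal rate in the plane of two thresholds\<close>

lemma upd2_apply: "upd2 G a b x k l = (if k = a \<and> l = b then x else G k l)"
  by (simp add: upd2_def)

lemma upd2_same: "upd2 G a b (G a b) = G"
  by (simp add: upd2_def)

lemma upd2_commute:
  "(a, b) \<noteq> (c, d) \<Longrightarrow> upd2 (upd2 G a b x) c d y = upd2 (upd2 G c d y) a b x"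
  by (auto simp: upd2_apply fun_eq_iff)

text \<open>For user \<open>i\<close>, the threshold \<open>G i j\<close> acts only through the
  maximal power and \<open>G j i\<close> only through the denominator, which is the shape treated by
  \<open>log_rate_line_derivative\<close>.\<close>

lemma opt_rate_line_derivative:
  fixes h :: "'k::finite \<Rightarrow> 'k \<Rightarrow> complex Matrix.vec"
  assumes channels: "\<And>l. h i l \<in> carrier_vec (M i)"
    and noise: "0 < \<sigma> i"
    and G_nonneg: "\<And>k. k \<noteq> i \<Longrightarrow> 0 \<le> G k i"
    and ij: "i \<noteq> j"
    and diff: "opt_rate_has_partial M h \<sigma> P G i i j"
  shows "((\<lambda>t. opt_rate M h \<sigma> P (upd2 (upd2 G i j (G i j + t * u)) j i (G j i + t * v)) i)
    has_real_derivative
      opt_rate_partial M h \<sigma> P G i i j * u + opt_rate_partial M h \<sigma> P G i j i * v) (at 0)"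
proof -
  define F where "F x y = opt_rate M h \<sigma> P (upd2 (upd2 G i j x) j i y) i" for x y
  define N where "N x = max_power M h P (upd2 G i j x) i" for x
  \<comment> \<open>Noise and interference from all users but \<open>j\<close>, so that the
    denominator for user \<open>i\<close> becomes \<open>y + c\<close>.\<close>
  define c where "c = (\<Sum>l\<in>UNIV - {i, j}. G l i) + (\<sigma> i)\<^sup>2"
  have feas: "\<forall>\<^sub>F x in nhds (G i j). feasible_cov M h P (upd2 G i j x) i \<noteq> {}"
    using diff by (simp add: opt_rate_has_partial_def)
  have F_slices: "(\<lambda>x. F x (G j i)) = (\<lambda>x. opt_rate M h \<sigma> P (upd2 G i j x) i)"
      "F (G i j) = (\<lambda>y. opt_rate M h \<sigma> P (upd2 G j i y) i)"
    using ij by (auto simp: F_def upd2_same upd2_commute[of i j j i])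
  have c: "0 < c"
    unfolding c_def using noise G_nonneg by (intro add_nonneg_pos sum_nonneg) auto
  have "\<forall>\<^sub>F x in nhds (G i j). \<forall>y. 0 < y + c \<longrightarrow> F x y = log 2 (1 + N x / (y + c))"
    using feas
  proof eventually_elim
    case (elim x)
    show ?case
    proof (intro allI impI)
      fix y assume y: "0 < y + c"
      let ?G = "upd2 (upd2 G i j x) j i y"
      have "UNIV - {i} = insert j (UNIV - {i, j})"
        using ij by auto
      then have den: "(\<Sum>l\<in>UNIV - {i}. ?G l i) + (\<sigma> i)\<^sup>2 = y + c"
        using ij by (simp add: c_def upd2_apply)
      have "feasible_cov M h P ?G i = feasible_cov M h P (upd2 G i j x) i"
        using ij by (intro feasible_cov_cong) (auto simp: upd2_apply)
      moreover have "max_power M h P ?G i = N x"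
        unfolding N_def using ij by (intro max_power_cong) (auto simp: upd2_apply)
      ultimately show "F x y = log 2 (1 + N x / (y + c))"
        using opt_rate_eq[of h i M P ?G \<sigma>] channels elim y by (simp add: F_def den)
    qed
  qed
  moreover have "\<forall>\<^sub>F x in nhds (G i j). 0 \<le> N x"
    using feas by eventually_elim (unfold N_def, rule max_power_nonneg, rule channels)
  moreover have "0 < G j i + c"
    using G_nonneg[of j] ij c by simp
  moreover have "(\<lambda>x. F x (G j i)) differentiable (at (G i j))"
    using diff by (simp add: F_slices opt_rate_has_partial_def)
  ultimately have "((\<lambda>t. F (G i j + t * u) (G j i + t * v)) has_real_derivative
      deriv (\<lambda>x. F x (G j i)) (G i j) * u + deriv (F (G i j)) (G j i) * v) (at 0)"
    by (rule log_rate_line_derivative)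
  then show ?thesis
    unfolding F_slices by (simp add: F_def opt_rate_partial_def)
qed

section \<open>Contradiction with Pareto optimality\<close>

lemma opt_rate_upd2_other:
  fixes h :: "'k::finite \<Rightarrow> 'k \<Rightarrow> complex Matrix.vec"
  assumes "k \<noteq> a" "k \<noteq> b"
  shows "opt_rate M h \<sigma> P (upd2 G a b x) k = opt_rate M h \<sigma> P G k"
proof -
  have "feasible_cov M h P (upd2 G a b x) k = feasible_cov M h P G k"
    using assms by (intro feasible_cov_cong) (auto simp: upd2_apply)
  then show ?thesis
    using assms by (simp add: opt_rate_def upd2_apply)
qed

theorem proposition4p1:
  fixes M :: "'k::finite \<Rightarrow> nat"
    and h :: "'k \<Rightarrow> 'k \<Rightarrow> complex Matrix.vec"
    and \<sigma> P :: "'k \<Rightarrow> real"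
    and G :: "'k \<Rightarrow> 'k \<Rightarrow> real"
    and i j :: 'k
  assumes antennas: "\<And>k. 1 \<le> M k"
    and channels: "\<And>k l. h k l \<in> carrier_vec (M k)"
    and noise: "\<And>k. 0 < \<sigma> k"
    and budget: "\<And>k. 0 \<le> P k"
    and G_nonneg: "\<And>k l. k \<noteq> l \<Longrightarrow> 0 \<le> G k l"
    and pareto: "pareto_optimal (rate_region M h \<sigma> P) (opt_rate M h \<sigma> P G)"
    and ij: "i \<noteq> j"
    and diff_i: "opt_rate_has_partial M h \<sigma> P G i i j"
    and diff_j: "opt_rate_has_partial M h \<sigma> P G j j i"
  shows "Determinants.det (D_matrix M h \<sigma> P G i j) = 0"
proof (rule ccontr)
  assume "Determinants.det (D_matrix M h \<sigma> P G i j) \<noteq> 0"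
  define p q r s where "p = opt_rate_partial M h \<sigma> P G i i j"
    and "q = opt_rate_partial M h \<sigma> P G i j i"
    and "r = opt_rate_partial M h \<sigma> P G j i j"
    and "s = opt_rate_partial M h \<sigma> P G j j i"
  \<comment> \<open>Cramer's rule for the system that requires both rates to grow at unit
    speed.\<close>
  define u v where "u = (s - q) / (p * s - q * r)" and "v = (p - r) / (p * s - q * r)"
  have "p * s - q * r \<noteq> 0"
    using \<open>Determinants.det (D_matrix M h \<sigma> P G i j) \<noteq> 0\<close>
    by (simp add: D_matrix_def det_2 p_def q_def r_def s_def)
  then have dir: "p * u + q * v = 1" "s * v + r * u = 1"
    by (simp_all add: u_def v_def divide_simps) (simp_all add: algebra_simps)
  define H where "H t = upd2 (upd2 G i j (G i j + t * u)) j i (G j i + t * v)" for t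
  \<comment> \<open>For user \<open>j\<close> the roles of the two thresholds are exchanged, so its
    own outgoing threshold has to be updated first.\<close>
  have H_swap: "H t = upd2 (upd2 G j i (G j i + t * v)) i j (G i j + t * u)" for t
    unfolding H_def using ij by (intro upd2_commute) auto
  have H0: "H 0 = G"
    by (simp add: H_def upd2_same)
  have "((\<lambda>t. opt_rate M h \<sigma> P (H t) i) has_real_derivative 1) (at 0)"
    using opt_rate_line_derivative[OF channels noise G_nonneg ij diff_i, of u v] dir(1)
    by (simp add: H_def p_def q_def)
  then obtain d where d: "0 < d" "\<And>t. 0 < t \<Longrightarrow> t < d \<Longrightarrow>
      opt_rate M h \<sigma> P G i < opt_rate M h \<sigma> P (H t) i"
    using DERIV_pos_inc_right[of "\<lambda>t. opt_rate M h \<sigma> P (H t) i" 1 0] by (auto simp: H0)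
  have "((\<lambda>t. opt_rate M h \<sigma> P (H t) j) has_real_derivative 1) (at 0)"
    using opt_rate_line_derivative[OF channels noise G_nonneg ij[symmetric] diff_j, of v u] dir(2)
    by (simp add: H_swap r_def s_def)
  then obtain e where e: "0 < e" "\<And>t. 0 < t \<Longrightarrow> t < e \<Longrightarrow>
      opt_rate M h \<sigma> P G j < opt_rate M h \<sigma> P (H t) j"
    using DERIV_pos_inc_right[of "\<lambda>t. opt_rate M h \<sigma> P (H t) j" 1 0] by (auto simp: H0)
  have lim: "((\<lambda>t. g + t * w) \<longlongrightarrow> g) (at_right 0)" for g w :: real
    by (auto intro!: tendsto_eq_intros)
  \<comment> \<open>Feasibility in a neighbourhood, part of \<open>opt_rate_has_partial\<close>, is
    pulled back along the line as \<open>t\<close> tends to 0 from the right.\<close>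
  have "\<forall>\<^sub>F t in at_right 0. feasible_cov M h P (upd2 G i j (G i j + t * u)) i \<noteq> {}"
    using diff_i lim[of "G i j" u] by (auto simp: opt_rate_has_partial_def filterlim_iff)
  moreover have "\<forall>\<^sub>F t in at_right 0. feasible_cov M h P (upd2 G j i (G j i + t * v)) j \<noteq> {}"
    using diff_j lim[of "G j i" v] by (auto simp: opt_rate_has_partial_def filterlim_iff)
  moreover have "\<forall>\<^sub>F t in at_right 0. 0 < t \<and> t < d \<and> t < e"
    using d(1) e(1) by (auto simp: eventually_at_right intro!: exI[of _ "min d e"])
  ultimately have "\<forall>\<^sub>F t in at_right 0. 0 < t \<and> t < d \<and> t < e \<and>
      feasible_cov M h P (upd2 G i j (G i j + t * u)) i \<noteq> {} \<and>
      feasible_cov M h P (upd2 G j i (G j i + t * v)) j \<noteq> {}"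
    by eventually_elim simp
  then obtain t :: real where t: "0 < t" "t < d" "t < e"
    and feas_i: "feasible_cov M h P (upd2 G i j (G i j + t * u)) i \<noteq> {}"
    and feas_j: "feasible_cov M h P (upd2 G j i (G j i + t * v)) j \<noteq> {}"
    using eventually_happens'[OF trivial_limit_at_right_real] by blast
  \<comment> \<open>The direction may have negative components; feasibility of the perturbed
    problems still keeps both thresholds nonnegative.\<close>
  have "0 \<le> G i j + t * u" "0 \<le> G j i + t * v"
    using feasible_cov_nonneg[OF channels feas_i, of j] feasible_cov_nonneg[OF channels feas_j, of i] ij
    by (auto simp: upd2_apply)
  then have H_nonneg: "0 \<le> H t k l" if "k \<noteq> l" for k l
    unfolding H_def upd2_apply using G_nonneg[OF that] by presburger
  \<comment> \<open>With all thresholds nonnegative, the zero covariance makes every user's problem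
    feasible, as achievability of the new tuple requires.\<close>
  have "0\<^sub>m (M k) (M k) \<in> feasible_cov M h P (H t) k" for k
    by (rule zero_mem_feasible_cov) (use channels budget H_nonneg in auto)
  then have "feasible_cov M h P (H t) k \<noteq> {}" for k
    by blast
  then have region: "opt_rate M h \<sigma> P (H t) \<in> rate_region M h \<sigma> P"
    by (intro opt_rate_in_rate_region channels noise H_nonneg)
  have "opt_rate M h \<sigma> P G k \<le> opt_rate M h \<sigma> P (H t) k" for k
  proof (cases "k = i \<or> k = j")
    case True
    then show ?thesis using d(2) e(2) t by fastforce
  next
    case False
    then show ?thesis by (simp add: H_def opt_rate_upd2_other)
  qed
  moreover have "opt_rate M h \<sigma> P (H t) \<noteq> opt_rate M h \<sigma> P G"
    using d(2)[of t] t by auto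
  ultimately show False
    using pareto region by (auto simp: pareto_optimal_def)
qed

end
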